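(* Let $(\mu,\nu)\in\mathbb{R}^2$ with $\mu\ge0$ be such that $T_{\mu\nu}$ has a nonzero bounded orbit, and put $a=\nu+\mu$. Then $-2\le a\le2$. Furthermore: (1) If $-2\le a<0$, then $$0\le\mu\le\frac{2}{|a|}-\frac{|a|}{2}.$$ (2) If $0\le a\le2$, write $a=2\cos\theta$. Then for each integer $n\ge2$, if $\frac{\pi}{n+1}<\theta<\frac{\pi}{n}$, there holds $$0\le\mu\le\cos\theta-\frac{\sin n\theta+\sin\theta}{\sin(n+1)\theta}.$$
   Context: For $(a,b)\in\mathbb{R}^2$ let $T_{ab}:\mathbb{R}^2\to\mathbb{R}^2$ be the homeomorphism $T_{ab}(x,y)=(ax-y,x)$ if $x\ge 0$ and $T_{ab}(x,y)=(bx-y,x)$ if $x<0$. The parameters $(\mu,\nu)\in\mathbb{R}^2$ are related to $(a,b)$ by $a=\nu+\mu$, $b=\nu-\mu$; one writes $T_{\mu\nu}$ for the same map $T_{ab}$. The orbit of $\mathbf{v}\in\mathbb{R}^2$ is the two-sided sequence $\{T_{\mu\nu}^{(n)}(\mathbf{v}):n\in\mathbb{Z}\}$ of iterates. It is nonzero if $\mathbf{v}\neq(0,0)$, and bounded if it is a bounded subset of $\mathbb{R}^2$.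
   Formalization: The case b = ν − μ = 2 with μ > 0 is excluded: there (−1,−1) is a fixed point of T, so a nonzero bounded orbit exists although a = 2 + 2μ > 2, and the claim a ≤ 2 fails for every such pair. *)

theory Defs
  imports "HOL-Analysis.Analysis"
begin

definition T_ab :: "real \<Rightarrow> real \<Rightarrow> real \<times> real \<Rightarrow> real \<times> real" where
  "T_ab a b = (\<lambda>(x, y). if x \<ge> 0 then (a * x - y, x) else (b * x - y, x))"

definition T_munu :: "real \<Rightarrow> real \<Rightarrow> real \<times> real \<Rightarrow> real \<times> real" where
  "T_munu \<mu> \<nu> = T_ab (\<nu> + \<mu>) (\<nu> - \<mu>)"

text \<open>Negative iterates use \<open>inv f\<close>, so this is meaningful for bijections only;
  see \<open>bij_T_munu\<close> below.\<close>

definition int_iterate :: "('a \<Rightarrow> 'a) \<Rightarrow> int \<Rightarrow> 'a \<Rightarrow> 'a" where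
  "int_iterate f n = (if n \<ge> 0 then f ^^ nat n else inv f ^^ nat (- n))"

definition full_orbit :: "('a \<Rightarrow> 'a) \<Rightarrow> 'a \<Rightarrow> 'a set" where
  "full_orbit f v = range (\<lambda>n::int. int_iterate f n v)"

definition has_nonzero_bounded_orbit :: "(real \<times> real \<Rightarrow> real \<times> real) \<Rightarrow> bool" where
  "has_nonzero_bounded_orbit f \<longleftrightarrow> (\<exists>v. v \<noteq> (0, 0) \<and> bounded (full_orbit f v))"

lemma bij_T_ab: "bij (T_ab a b)"
proof (rule o_bij)
  let ?g = "\<lambda>(x, y). (y, (if y \<ge> 0 then a * y - x else b * y - x)) :: real \<times> real"
  show "?g \<circ> T_ab a b = id"
    by (auto simp: fun_eq_iff T_ab_def)
  show "T_ab a b \<circ> ?g = id"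
    by (auto simp: fun_eq_iff T_ab_def)
qed

lemma bij_T_munu: "bij (T_munu \<mu> \<nu>)"
  by (simp add: T_munu_def bij_T_ab)

lemma full_orbit_fixed_point:
  assumes "bij f" "f v = v"
  shows "full_orbit f v = {v}"
proof -
  have f: "(f ^^ k) v = v" for k
    by (induction k) (simp_all add: assms)
  have "inv f v = v"
    using assms by (metis bij_inv_eq_iff)
  then have g: "(inv f ^^ k) v = v" for k
    by (induction k) simp_all
  show ?thesis
    by (auto simp: full_orbit_def int_iterate_def f g)
qed

text \<open>On the line \<open>b = \<nu> - \<mu> = 2\<close> the point \<open>(-1, -1)\<close> is fixed, whatever the value of
  \<open>a = \<nu> + \<mu> = 2 + 2 * \<mu>\<close>. For \<open>\<mu> > 0\<close> this gives a nonzero bounded orbit although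
  \<open>a > 2\<close>, so a nonzero bounded orbit and \<open>\<mu> \<ge> 0\<close> alone do not imply \<open>a \<le> 2\<close>.\<close>

lemma bounded_orbit_exceptional_line:
  assumes "\<nu> - \<mu> = 2"
  shows "has_nonzero_bounded_orbit (T_munu \<mu> \<nu>)"
proof -
  have "T_munu \<mu> \<nu> (-1, -1) = (-1, -1)"
    using assms by (simp add: T_munu_def T_ab_def)
  then have "full_orbit (T_munu \<mu> \<nu>) (-1, -1) = {(-1, -1)}"
    by (intro full_orbit_fixed_point bij_T_munu)
  then have "bounded (full_orbit (T_munu \<mu> \<nu>) (-1, -1))"
    by simp
  then show ?thesis
    unfolding has_nonzero_bounded_orbit_def by (intro exI[of _ "(-1, -1)"]) simp
qed

lemma a_le_2_fails_on_exceptional_line: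
  "\<exists>\<mu> \<nu>. \<mu> \<ge> 0 \<and> has_nonzero_bounded_orbit (T_munu \<mu> \<nu>) \<and> \<not> \<nu> + \<mu> \<le> 2"
proof (intro exI conjI)
  show "has_nonzero_bounded_orbit (T_munu (1/2) (5/2))"
    by (rule bounded_orbit_exceptional_line) simp
qed simp_all

end

theory Submission
  imports Defs
begin

text \<open>
  Along an orbit the first coordinates satisfy \<open>z (k + 1) + z (k - 1) = max (a * z k) (b * z k)\<close>,
  a recurrence that is symmetric under time reversal. For \<open>\<bar>a\<bar> > 2\<close> either \<open>z\<close> or \<open>\<bar>z\<bar>\<close> is convex,
  hence constant if bounded.

  For the upper bounds on \<open>\<mu>\<close>, suppose the bound fails. At an index with \<open>z k < 0\<close> one of the two
  neighbours is at least \<open>b * z k / 2\<close>; by symmetry let it be the next one. Then \<open>z\<close> follows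
  the linear recurrence with parameter \<open>a\<close> for \<open>n\<close> steps, and at step \<open>n + 1\<close> it reaches a value
  \<open>\<le> \<kappa> * z k\<close>, with a fixed \<open>\<kappa> > 1\<close>, whose successor is again at least \<open>b/2\<close> times it. Hence
  the orbit grows geometrically. The first bound is the case \<open>n = 1\<close>.
\<close>

section \<open>Orbits as two-sided scalar recurrences\<close>

text \<open>The map copies the old first coordinate into the second slot, so an orbit is determined
  by its first coordinates. Indexing by \<open>int\<close> keeps time reversal available as
  \<open>k \<mapsto> - k\<close>.\<close>

definition pl_recurrence :: "real \<Rightarrow> real \<Rightarrow> (int \<Rightarrow> real) \<Rightarrow> bool" where
  "pl_recurrence a b z \<longleftrightarrow>
    (\<forall>k. z (k + 1) + z (k - 1) = (if z k \<ge> 0 then a else b) * z k)"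

lemma pl_recurrenceD:
  "pl_recurrence a b z \<Longrightarrow> z (k + 1) + z (k - 1) = (if z k \<ge> 0 then a else b) * z k"
  by (simp add: pl_recurrence_def)

lemma pl_recurrence_shift:
  assumes "pl_recurrence a b z"
  shows "pl_recurrence a b (\<lambda>k. z (i + k))"
  using pl_recurrenceD[OF assms, of "i + _"]
  by (simp add: pl_recurrence_def algebra_simps)

lemma pl_recurrence_reflect:
  assumes "pl_recurrence a b z"
  shows "pl_recurrence a b (\<lambda>k. z (- k))"
  unfolding pl_recurrence_def
proof
  fix k :: int
  have idx: "- (k + 1) = - k - 1" "- (k - 1) = - k + 1" by simp_all
  show "z (- (k + 1)) + z (- (k - 1)) = (if z (- k) \<ge> 0 then a else b) * z (- k)"
    using pl_recurrenceD[OF assms, of "- k"] unfolding idx by (simp only: add.commute)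
qed

lemma int_iterate_add_1:
  assumes "bij f"
  shows "int_iterate f (k + 1) v = f (int_iterate f k v)"
proof (cases "k \<ge> 0")
  case True
  then have "nat (k + 1) = Suc (nat k)" by simp
  with True show ?thesis by (simp add: int_iterate_def)
next
  case False
  then have "nat (- k) = Suc (nat (- (k + 1)))" by simp
  moreover have "f (inv f w) = w" for w
    using assms by (simp add: bij_is_surj surj_f_inv_f)
  ultimately show ?thesis
    \<comment> \<open>At \<open>k = -1\<close> the index \<open>k + 1 = 0\<close> falls into the
      nonnegative branch of \<open>int_iterate\<close>.\<close>
    using False by (cases "k = -1") (simp_all add: int_iterate_def)
qed

lemma bounded_orbit_imp_pl_recurrence:
  assumes "has_nonzero_bounded_orbit (T_ab a b)"
  obtains z i B where "pl_recurrence a b z" "z i \<noteq> 0" "\<And>k. \<bar>z k\<bar> \<le> B"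
proof -
  obtain v where v: "v \<noteq> (0, 0)" and bd: "bounded (full_orbit (T_ab a b) v)"
    using assms by (auto simp: has_nonzero_bounded_orbit_def)
  define w where "w k = int_iterate (T_ab a b) k v" for k
  define z where "z k = fst (w k)" for k
  have step: "w (k + 1) = T_ab a b (w k)" for k
    by (simp add: w_def int_iterate_add_1 bij_T_ab)
  have prev: "snd (w k) = z (k - 1)" for k
    using step[of "k - 1"] by (simp add: z_def T_ab_def split: prod.splits)
  have "pl_recurrence a b z"
    unfolding pl_recurrence_def
  proof
    fix k
    show "z (k + 1) + z (k - 1) = (if z k \<ge> 0 then a else b) * z k"
      using step[of k] prev[of k] by (auto simp: z_def T_ab_def split: prod.splits)
  qed
  \<comment> \<open>The starting point is \<open>(z 0, z (- 1))\<close>.\<close>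
  moreover have "z 0 \<noteq> 0 \<or> z (- 1) \<noteq> 0"
    using v prev[of 0] by (cases v) (auto simp: z_def w_def int_iterate_def)
  moreover obtain B where B: "\<forall>x \<in> full_orbit (T_ab a b) v. norm x \<le> B"
    using bd by (auto simp: bounded_iff)
  have "\<bar>z k\<bar> \<le> B" for k
  proof -
    have "w k \<in> full_orbit (T_ab a b) v" by (simp add: w_def full_orbit_def)
    with B have "norm (w k) \<le> B" by blast
    then show ?thesis
      using norm_fst_le[of "fst (w k)" "snd (w k)"] by (simp add: z_def)
  qed
  ultimately show ?thesis using that by blast
qed

section \<open>Bounded convex sequences and \<open>\<bar>a\<bar> > 2\<close>\<close>

text \<open>Convexity makes increments nondecreasing, so a single positive increment forces at least
  linear growth to the right.\<close>

lemma increment_nonpos_of_bounded_convex: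
  fixes y :: "int \<Rightarrow> real"
  assumes convex: "\<And>k. 2 * y k \<le> y (k + 1) + y (k - 1)"
    and bounded: "\<And>k. \<bar>y k\<bar> \<le> B"
  shows "y (i + 1) \<le> y i"
proof (rule ccontr)
  assume "\<not> y (i + 1) \<le> y i"
  define d where "d = y (i + 1) - y i"
  then have "d > 0" using \<open>\<not> y (i + 1) \<le> y i\<close> by simp
  have incr: "y (i + int m + 1) - y (i + int m) \<ge> d" for m
  proof (induction m)
    case (Suc m)
    then show ?case
      using convex[of "i + int m + 1"] by (simp add: algebra_simps)
  qed (simp add: d_def)
  have grow: "y (i + int m) \<ge> y i + real m * d" for m
  proof (induction m)
    case (Suc m)
    then show ?case using incr[of m] by (simp add: algebra_simps)
  qed simp
  obtain m where "real m * d > 2 * B"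
    using reals_Archimedean3[OF \<open>d > 0\<close>] by blast
  then show False
    using grow[of m] bounded[of i] bounded[of "i + int m"] by linarith
qed

lemma bounded_convex_constant:
  fixes y :: "int \<Rightarrow> real"
  assumes convex: "\<And>k. 2 * y k \<le> y (k + 1) + y (k - 1)"
    and bounded: "\<And>k. \<bar>y k\<bar> \<le> B"
  shows "y (i + 1) = y i"
proof (rule antisym)
  show "y (i + 1) \<le> y i"
    using assms by (rule increment_nonpos_of_bounded_convex)
  have idx: "- (k + 1) = - k - 1" "- (k - 1) = - k + 1" for k :: int by simp_all
  have "2 * y (- k) \<le> y (- (k + 1)) + y (- (k - 1))" for k
    using convex[of "- k"] unfolding idx by (simp only: add.commute)
  \<comment> \<open>In the reversed sequence the step from \<open>- i - 1\<close> to
    \<open>- i\<close> leads from \<open>y (i + 1)\<close> to \<open>y i\<close>.\<close>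
  from increment_nonpos_of_bounded_convex[where y = "\<lambda>k. y (- k)" and i = "- i - 1", OF this bounded]
  show "y i \<le> y (i + 1)" by (simp add: algebra_simps)
qed

text \<open>Nonnegativity turns the factor \<open>c > 2\<close> into ordinary convexity, so
  \<open>y\<close> is constant; then \<open>c * y i \<le> 2 * y i\<close> forces zero.\<close>

lemma bounded_strictly_convex_eq_0:
  fixes y :: "int \<Rightarrow> real"
  assumes convex: "\<And>k. c * y k \<le> y (k + 1) + y (k - 1)"
    and nonneg: "\<And>k. 0 \<le> y k" and bounded: "\<And>k. y k \<le> B" and "c > 2"
  shows "y i = 0"
proof -
  have "2 * y k \<le> y (k + 1) + y (k - 1)" for k
    using convex[of k] mult_right_mono[of 2 c "y k"] nonneg[of k] \<open>c > 2\<close> by linarith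
  then have const: "y (k + 1) = y k" for k
    by (rule bounded_convex_constant[where B = B]) (simp add: nonneg bounded)
  have "(c - 2) * y i \<le> 0"
    using convex[of i] const[of i] const[of "i - 1"] by (simp add: algebra_simps)
  then show ?thesis
    using nonneg[of i] \<open>c > 2\<close> by (simp add: mult_le_0_iff)
qed

lemma bounded_pl_recurrence_expanding_eq_0:
  assumes rec: "pl_recurrence a b z" and bounded: "\<And>k. \<bar>z k\<bar> \<le> B"
    and "c > 2" "c \<le> \<bar>a\<bar>" "c \<le> \<bar>b\<bar>"
  shows "z i = 0"
proof -
  have "c * \<bar>z k\<bar> \<le> \<bar>z (k + 1)\<bar> + \<bar>z (k - 1)\<bar>" for k
  proof -
    have "c * \<bar>z k\<bar> \<le> \<bar>(if z k \<ge> 0 then a else b) * z k\<bar>"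
      unfolding abs_mult using assms(4,5) by (intro mult_right_mono) auto
    also have "\<dots> = \<bar>z (k + 1) + z (k - 1)\<bar>"
      using pl_recurrenceD[OF rec, of k] by simp
    also have "\<dots> \<le> \<bar>z (k + 1)\<bar> + \<bar>z (k - 1)\<bar>" by (rule abs_triangle_ineq)
    finally show ?thesis .
  qed
  then have "\<bar>z i\<bar> = 0"
    by (rule bounded_strictly_convex_eq_0[where B = B]) (use bounded \<open>c > 2\<close> in auto)
  then show ?thesis by simp
qed

text \<open>With 2 strictly between the slopes, \<open>z\<close> itself is convex, hence constant,
  and a nonzero constant solution would need slope 2 on its side of zero.\<close>

lemma bounded_pl_recurrence_convex_eq_0:
  assumes rec: "pl_recurrence a b z" and bounded: "\<And>k. \<bar>z k\<bar> \<le> B"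
    and "a > 2" "b < 2"
  shows "z i = 0"
proof -
  have gap: "2 * z k \<le> (if z k \<ge> 0 then a else b) * z k" for k
    using assms(3,4) by (auto intro: mult_right_mono mult_right_mono_neg)
  then have "2 * z k \<le> z (k + 1) + z (k - 1)" for k
    using pl_recurrenceD[OF rec, of k] gap[of k] by simp
  then have const: "z (k + 1) = z k" for k
    using bounded by (rule bounded_convex_constant)
  have "(if z i \<ge> 0 then a else b) * z i = 2 * z i"
    using pl_recurrenceD[OF rec, of i] const[of i] const[of "i - 1"] by simp
  then show ?thesis using assms(3,4) by (auto split: if_splits)
qed

section \<open>Chebyshev values and linear runs\<close>

text \<open>\<open>cheb a k\<close> is the Chebyshev polynomial \<open>U\<^sub>k\<^sub>-\<^sub>1\<close> at \<open>a / 2\<close>.\<close>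

fun cheb :: "real \<Rightarrow> nat \<Rightarrow> real" where
  "cheb a 0 = 0"
| "cheb a (Suc 0) = 1"
| "cheb a (Suc (Suc k)) = a * cheb a (Suc k) - cheb a k"

lemma cheb_cos: "cheb (2 * cos \<theta>) k * sin \<theta> = sin (real k * \<theta>)"
proof (induction "2 * cos \<theta>" k rule: cheb.induct)
  case (3 k)
  have "sin (real (Suc (Suc k)) * \<theta>) + sin (real k * \<theta>) = 2 * cos \<theta> * sin (real (Suc k) * \<theta>)"
    using sin_add[of "real (Suc k) * \<theta>" \<theta>] sin_diff[of "real (Suc k) * \<theta>" \<theta>]
    by (simp add: algebra_simps)
  with 3 show ?case by (simp add: left_diff_distrib mult.assoc)
qed auto

text \<open>This is the determinant of a power of the companion matrix of the linear recurrence,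
  which has determinant 1.\<close>

lemma cheb_cassini: "(cheb a (Suc n))\<^sup>2 - cheb a (Suc (Suc n)) * cheb a n = 1"
  by (induction n) (simp_all add: power2_eq_square algebra_simps)

text \<open>Only slope \<open>a\<close> acts during such a run. The recurrence is applied at indices
  from 1 on, so \<open>z 0\<close> may be negative.\<close>

lemma pl_recurrence_nonneg_run:
  assumes rec: "pl_recurrence a b z"
    and "\<And>k. 1 \<le> k \<Longrightarrow> k \<le> m \<Longrightarrow> z (int k) \<ge> 0"
  shows "z (int (Suc m)) = z 1 * cheb a (Suc m) - z 0 * cheb a m"
  using assms(2)
proof (induction m rule: induct_nat_012)
  case 1
  then show ?case using pl_recurrenceD[OF rec, of 1] 1[of 1] by (simp add: algebra_simps)
next
  case (ge2 m)
  have "z (int (Suc m)) = z 1 * cheb a (Suc m) - z 0 * cheb a m"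
    "z (int (Suc (Suc m))) = z 1 * cheb a (Suc (Suc m)) - z 0 * cheb a (Suc m)"
    using ge2.IH ge2.prems by (auto simp del: of_nat_Suc)
  moreover have "z (int (Suc (Suc (Suc m)))) = a * z (int (Suc (Suc m))) - z (int (Suc m))"
    using pl_recurrenceD[OF rec, of "int (Suc (Suc m))"] ge2.prems[of "Suc (Suc m)"]
    by (simp add: algebra_simps)
  ultimately show ?case by (simp del: of_nat_Suc) (simp add: algebra_simps)
qed simp

section \<open>Geometric growth when the bound on \<mu> fails\<close>

text \<open>For \<open>a = 2 * cos \<theta>\<close> the sign conditions hold when \<theta> lies
  strictly between \<open>pi / (n + 1)\<close> and \<open>pi / n\<close>. \<open>b_small\<close>
  says exactly that the growth factor \<open>b * cheb a (Suc n) / 2 - cheb a n\<close> exceeds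
  1.\<close>

context
  fixes a b :: real and n :: nat
  assumes n: "n \<ge> 1"
    and cheb_pos: "\<And>k. 1 \<le> k \<Longrightarrow> k \<le> n \<Longrightarrow> cheb a k > 0"
    and cheb_neg: "cheb a (Suc n) < 0"
    and b_small: "b * cheb a (Suc n) > 2 * (cheb a n + 1)"
begin

text \<open>A nonnegative solution would obey the linear formula from \<open>i\<close> on, which is
  negative after \<open>n + 1\<close> steps.\<close>

lemma pl_recurrence_ex_neg:
  assumes rec: "pl_recurrence a b z" and nz: "z i \<noteq> 0"
  obtains j where "z j < 0"
proof -
  have "\<exists>j. z j < 0"
  proof (rule ccontr)
    assume "\<not> (\<exists>j. z j < 0)"
    then have nonneg: "z j \<ge> 0" for j by (simp add: not_less)
    have "z (i + int (Suc n)) = z (i + 1) * cheb a (Suc n) - z i * cheb a n"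
      using pl_recurrence_nonneg_run[OF pl_recurrence_shift[OF rec, of i], of n] nonneg by simp
    moreover have "z (i + 1) * cheb a (Suc n) \<le> 0"
      using nonneg[of "i + 1"] cheb_neg by (simp add: mult_le_0_iff)
    moreover have "z i * cheb a n > 0"
      using nonneg[of i] nz n cheb_pos[of n] by simp
    ultimately show False using nonneg[of "i + int (Suc n)"] by simp
  qed
  then show ?thesis using that by blast
qed

text \<open>The second conclusion is the hypothesis \<open>up\<close> moved to index
  \<open>n + 1\<close>, so the estimate can be iterated.\<close>

lemma pl_recurrence_return:
  assumes rec: "pl_recurrence a b z" and neg: "z 0 < 0" and up: "z 1 \<ge> b * z 0 / 2"
  shows "z (int (Suc n)) \<le> (b * cheb a (Suc n) / 2 - cheb a n) * z 0"
    and "z (int (Suc n) + 1) \<ge> b * z (int (Suc n)) / 2"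
proof -
  have cn: "cheb a n > 0" using n cheb_pos by simp
  have "b < 0"
  proof (rule ccontr)
    assume "\<not> b < 0"
    then have "b * cheb a (Suc n) \<le> 0" using cheb_neg by (simp add: mult_le_0_iff)
    then show False using b_small cn by simp
  qed
  then have z1: "z 1 \<ge> 0"
    using up neg mult_neg_neg[of b "z 0"] by simp
  \<comment> \<open>Strong induction, since the run formula needs all earlier signs; both of its
    terms are then nonnegative.\<close>
  have run: "z (int (Suc k)) \<ge> 0" if "k < n" for k
    using that
  proof (induction k rule: less_induct)
    case (less k)
    have "z (int j) \<ge> 0" if "1 \<le> j" "j \<le> k" for j
      using less.IH[of "j - 1"] less.prems that by simp
    then have "z (int (Suc k)) = z 1 * cheb a (Suc k) - z 0 * cheb a k"
      by (intro pl_recurrence_nonneg_run[OF rec])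
    moreover have "z 1 * cheb a (Suc k) \<ge> 0"
      using z1 cheb_pos[of "Suc k"] less.prems by simp
    moreover have "z 0 * cheb a k \<le> 0"
      using neg cheb_pos[of k] less.prems by (cases "k = 0") (auto simp: mult_le_0_iff)
    ultimately show ?case by simp
  qed
  have nonneg: "z (int k) \<ge> 0" if "1 \<le> k" "k \<le> n" for k
    using run[of "k - 1"] that by simp
  have z_Suc: "z (int (Suc n)) = z 1 * cheb a (Suc n) - z 0 * cheb a n"
    using nonneg by (rule pl_recurrence_nonneg_run[OF rec])
  have "z 1 * cheb a (Suc n) \<le> b * z 0 / 2 * cheb a (Suc n)"
    using up cheb_neg by (intro mult_right_mono_neg) simp_all
  then show ret: "z (int (Suc n)) \<le> (b * cheb a (Suc n) / 2 - cheb a n) * z 0"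
    unfolding z_Suc by argo
  have "(b * cheb a (Suc n) / 2 - cheb a n) * z 0 \<le> 1 * z 0"
    using b_small neg by (intro mult_right_mono_neg) simp_all
  with ret have grow: "z (int (Suc n)) \<le> z 0" by simp
  obtain m where m: "n = Suc m" using n by (cases n) auto
  have z_n: "z (int n) = z 1 * cheb a n - z 0 * cheb a m"
    using pl_recurrence_nonneg_run[OF rec, of m] nonneg m by simp
  \<comment> \<open>Eliminating \<open>z 1\<close> from \<open>z_n\<close> and \<open>z_Suc\<close>
    leaves the Cassini expression as the coefficient of \<open>z 0\<close>.\<close>
  have "z (int n) * cheb a (Suc n) = z (int (Suc n)) * cheb a n
      + z 0 * ((cheb a n)\<^sup>2 - cheb a (Suc n) * cheb a m)"
    by (simp only: z_n z_Suc power2_eq_square) (simp add: algebra_simps)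
  also have "(cheb a n)\<^sup>2 - cheb a (Suc n) * cheb a m = 1"
    using cheb_cassini[of a m] m by simp
  also have "z (int (Suc n)) * cheb a n + z 0 * 1 \<ge> z (int (Suc n)) * (cheb a n + 1)"
    using grow by (simp add: algebra_simps)
  also have "z (int (Suc n)) * (cheb a n + 1) \<ge> z (int (Suc n)) * (b * cheb a (Suc n) / 2)"
    using grow neg b_small by (intro mult_left_mono_neg) simp_all
  finally have "b * z (int (Suc n)) / 2 * cheb a (Suc n) \<le> z (int n) * cheb a (Suc n)"
    by (simp add: algebra_simps)
  then have "z (int n) \<le> b * z (int (Suc n)) / 2"
    using cheb_neg by (simp add: mult_le_cancel_right)
  \<comment> \<open>The two neighbours sum to \<open>b * z (int (Suc n))\<close>; the left one is at
    most half of it, so the right one is at least half.\<close>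
  moreover have "z (int (Suc n) + 1) + z (int n) = b * z (int (Suc n))"
    using pl_recurrenceD[OF rec, of "int (Suc n)"] grow neg by simp
  ultimately show "z (int (Suc n) + 1) \<ge> b * z (int (Suc n)) / 2" by simp
qed

lemma pl_recurrence_unbounded_forward:
  assumes rec: "pl_recurrence a b z" and neg: "z 0 < 0" and up: "z 1 \<ge> b * z 0 / 2"
    and bounded: "\<And>k. \<bar>z k\<bar> \<le> B"
  shows False
proof -
  define \<kappa> where "\<kappa> = b * cheb a (Suc n) / 2 - cheb a n"
  have \<kappa>: "\<kappa> > 1" using b_small by (simp add: \<kappa>_def)
  have "z (int (m * Suc n)) \<le> \<kappa> ^ m * z 0
      \<and> z (int (m * Suc n) + 1) \<ge> b * z (int (m * Suc n)) / 2" for m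
  proof (induction m)
    \<comment> \<open>The sign of the current value must be recovered before the return estimate can
      be applied again.\<close>
    case (Suc m)
    have "\<kappa> ^ m * z 0 < 0" using neg \<kappa> by (simp add: mult_less_0_iff)
    with Suc have zneg: "z (int (m * Suc n)) < 0" by simp
    have idx: "int (Suc m * Suc n) = int (m * Suc n) + int (Suc n)" by simp
    note ret = pl_recurrence_return[OF pl_recurrence_shift[OF rec, of "int (m * Suc n)"]]
    have "z (int (Suc m * Suc n)) \<le> \<kappa> * z (int (m * Suc n))"
      unfolding idx \<kappa>_def using ret(1) zneg Suc by simp
    also have "\<dots> \<le> \<kappa> * (\<kappa> ^ m * z 0)" using Suc \<kappa> by (intro mult_left_mono) auto
    finally have "z (int (Suc m * Suc n)) \<le> \<kappa> ^ Suc m * z 0" by (simp add: mult.assoc)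
    moreover have "z (int (Suc m * Suc n) + 1) \<ge> b * z (int (Suc m * Suc n)) / 2"
      unfolding idx using ret(2) zneg Suc by (simp add: add.assoc)
    ultimately show ?case by blast
  qed (use up in simp)
  then have le: "z (int (m * Suc n)) \<le> \<kappa> ^ m * z 0" for m by blast
  obtain m where "B / - z 0 < \<kappa> ^ m" using real_arch_pow[OF \<kappa>] by blast
  then have "B < \<kappa> ^ m * - z 0" using neg by (subst (asm) pos_divide_less_eq) auto
  then show False using le[of m] bounded[of "int (m * Suc n)"] by simp
qed

lemma bounded_pl_recurrence_eq_0:
  assumes rec: "pl_recurrence a b z" and bounded: "\<And>k. \<bar>z k\<bar> \<le> B"
  shows "z i = 0"
proof (rule ccontr)
  assume "z i \<noteq> 0"
  with rec obtain j where neg: "z j < 0" by (rule pl_recurrence_ex_neg)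
  let ?f = "\<lambda>k. z (j + k)"
  have f: "pl_recurrence a b ?f" using rec by (rule pl_recurrence_shift)
  have "z (j + 1) + z (j - 1) = b * z j"
    using pl_recurrenceD[OF rec, of j] neg by simp
  then consider "z (j + 1) \<ge> b * z j / 2" | "z (j - 1) \<ge> b * z j / 2" by linarith
  then show False
  proof cases
    case 1
    show ?thesis
      by (rule pl_recurrence_unbounded_forward[OF f, where B = B]) (use neg 1 bounded in auto)
  next
    case 2
    show ?thesis
      by (rule pl_recurrence_unbounded_forward[OF pl_recurrence_reflect[OF f], where B = B])
        (use neg 2 bounded in auto)
  qed
qed

end

section \<open>Trigonometric translation and the final bounds\<close>

lemma cheb_cos_pos:
  assumes "0 < \<theta>" "\<theta> < pi" "0 < real k * \<theta>" "real k * \<theta> < pi"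
  shows "cheb (2 * cos \<theta>) k > 0"
  using cheb_cos[of \<theta> k] sin_gt_zero[of \<theta>] sin_gt_zero[of "real k * \<theta>"] assms
  by (metis zero_less_mult_pos2)

theorem theorem2p2:
  fixes \<mu> \<nu> a :: real
  assumes mu_nonneg: "\<mu> \<ge> 0"
    and orbit: "has_nonzero_bounded_orbit (T_munu \<mu> \<nu>)"
    and a: "a = \<nu> + \<mu>"
    and not_exceptional: "\<not> (\<nu> - \<mu> = 2 \<and> \<mu> > 0)"
  shows "-2 \<le> a \<and> a \<le> 2 \<and>
    (-2 \<le> a \<and> a < 0 \<longrightarrow> 0 \<le> \<mu> \<and> \<mu> \<le> 2 / \<bar>a\<bar> - \<bar>a\<bar> / 2) \<and>
    (0 \<le> a \<and> a \<le> 2 \<longrightarrow>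
      (\<forall>\<theta>::real. a = 2 * cos \<theta> \<longrightarrow>
        (\<forall>n::nat. n \<ge> 2 \<longrightarrow> pi / real (n + 1) < \<theta> \<and> \<theta> < pi / real n \<longrightarrow>
          0 \<le> \<mu> \<and>
          \<mu> \<le> cos \<theta> - (sin (real n * \<theta>) + sin \<theta>) / sin (real (n + 1) * \<theta>))))"
proof -
  define b where "b = \<nu> - \<mu>"
  have b: "b = a - 2 * \<mu>" by (simp add: a b_def)
  have "has_nonzero_bounded_orbit (T_ab a b)"
    using orbit by (simp add: T_munu_def a b_def)
  then obtain z i B where rec: "pl_recurrence a b z" and nz: "z i \<noteq> 0"
    and bounded: "\<And>k. \<bar>z k\<bar> \<le> B"
    by (rule bounded_orbit_imp_pl_recurrence) blast
  have lower: "-2 \<le> a"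
  proof (rule ccontr)
    assume "\<not> -2 \<le> a"
    then have "z i = 0"
      using b mu_nonneg
      \<comment> \<open>Here \<open>b \<le> a < -2\<close>, so \<open>- a\<close> is the smaller
        absolute slope.\<close>
      by (intro bounded_pl_recurrence_expanding_eq_0[OF rec bounded, where c = "- a"]) auto
    with nz show False ..
  qed
  have upper: "a \<le> 2"
  proof (rule ccontr)
    assume *: "\<not> a \<le> 2"
    \<comment> \<open>If \<open>b = 2\<close>, then \<open>a > 2\<close> would give
      \<open>\<mu> > 0\<close>, the excluded case.\<close>
    then consider "b < 2" | "b > 2"
      using not_exceptional mu_nonneg b by (fold b_def) fastforce
    then have "z i = 0"
    proof cases
      case 1
      then show ?thesis
        using * by (intro bounded_pl_recurrence_convex_eq_0[OF rec bounded]) auto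
    next
      case 2
      then show ?thesis
        using b mu_nonneg
        by (intro bounded_pl_recurrence_expanding_eq_0[OF rec bounded, where c = b]) auto
    qed
    with nz show False ..
  qed
  have case1: "\<mu> \<le> 2 / \<bar>a\<bar> - \<bar>a\<bar> / 2" if "a < 0"
  proof (rule ccontr)
    assume "\<not> \<mu> \<le> 2 / \<bar>a\<bar> - \<bar>a\<bar> / 2"
    \<comment> \<open>This is the value of \<open>b\<close> at the critical \<mu>; beyond it
      \<open>b * a > 4\<close>, which is \<open>b_small\<close> for \<open>n = 1\<close>.\<close>
    moreover have "a - 2 * (2 / \<bar>a\<bar> - \<bar>a\<bar> / 2) = 4 / a" using that by (simp add: field_simps)
    ultimately have "b < 4 / a" using b by argo
    then have "b * a > 4" using that by (simp add: neg_less_divide_eq)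
    then have "z i = 0"
      using that by (intro bounded_pl_recurrence_eq_0[OF _ _ _ _ rec bounded, where n = 1])
        (auto simp: le_Suc_eq numeral_2_eq_2)
    with nz show False ..
  qed
  have case2: "\<mu> \<le> cos \<theta> - (sin (real n * \<theta>) + sin \<theta>) / sin (real (n + 1) * \<theta>)"
    if a\<theta>: "a = 2 * cos \<theta>" and n: "n \<ge> 2" and \<theta>: "pi / real (n + 1) < \<theta>" "\<theta> < pi / real n"
    for \<theta> and n :: nat
  proof (rule ccontr)
    assume *: "\<not> \<mu> \<le> cos \<theta> - (sin (real n * \<theta>) + sin \<theta>) / sin (real (n + 1) * \<theta>)"
    have n\<theta>: "real n * \<theta> < pi" "pi < real (n + 1) * \<theta>"
      using \<theta> n by (simp_all add: field_simps)
    have "0 < \<theta>" using \<theta>(1) by (rule less_trans[rotated]) simp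
    have "2 * \<theta> \<le> real n * \<theta>" using n \<open>0 < \<theta>\<close> by (intro mult_right_mono) auto
    with n\<theta> have "2 * \<theta> < pi" by simp
    have "\<theta> < pi" using \<open>2 * \<theta> < pi\<close> \<open>0 < \<theta>\<close> by simp
    have sin\<theta>: "sin \<theta> > 0" using \<open>0 < \<theta>\<close> \<open>\<theta> < pi\<close> by (rule sin_gt_zero)
    \<comment> \<open>The angle \<open>(n + 1) * \<theta>\<close> stays in the half-turn after
      \<open>pi\<close>, where sine is negative.\<close>
    have "real (n + 1) * \<theta> < 2 * pi"
      using n\<theta>(1) \<open>\<theta> < pi\<close> by (simp add: algebra_simps)
    then have sin_neg: "sin (real (n + 1) * \<theta>) < 0"
      using n\<theta>(2) by (intro sin_lt_zero)
    have pos: "cheb a k > 0" if "1 \<le> k" "k \<le> n" for k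
    proof -
      have "real k * \<theta> \<le> real n * \<theta>" using that \<open>0 < \<theta>\<close> by (intro mult_right_mono) auto
      then have "real k * \<theta> < pi" using n\<theta>(1) by (rule le_less_trans)
      then show ?thesis
        unfolding a\<theta> using that \<open>0 < \<theta>\<close> \<open>\<theta> < pi\<close> by (intro cheb_cos_pos) auto
    qed
    have ch: "cheb a k * sin \<theta> = sin (real k * \<theta>)" for k
      unfolding a\<theta> by (rule cheb_cos)
    have neg: "cheb a (Suc n) < 0"
      using ch[of "Suc n"] sin_neg sin\<theta> by (metis Suc_eq_plus1 mult_less_0_iff not_less_iff_gr_or_eq)
    \<comment> \<open>Since \<open>b = 2 * cos \<theta> - 2 * \<mu>\<close>, the cosine cancels from
      the negated bound.\<close>
    have "b < 2 * (sin (real n * \<theta>) + sin \<theta>) / sin (real (n + 1) * \<theta>)"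
      using * b a\<theta> unfolding times_divide_eq_right[symmetric] by linarith
    then have "b * sin (real (n + 1) * \<theta>) > 2 * (sin (real n * \<theta>) + sin \<theta>)"
      using sin_neg by (simp only: neg_less_divide_eq)
    then have "b * cheb a (Suc n) * sin \<theta> > 2 * (cheb a n + 1) * sin \<theta>"
      using ch[of n] ch[of "Suc n"] by (simp add: algebra_simps)
    then have big: "b * cheb a (Suc n) > 2 * (cheb a n + 1)"
      using sin\<theta> by (simp only: mult_less_cancel_right_pos)
    have "z i = 0"
      using n pos neg big by (intro bounded_pl_recurrence_eq_0[OF _ _ _ _ rec bounded, where n = n]) auto
    with nz show False ..
  qed
  show ?thesis
    using lower upper case1 case2 mu_nonneg by blast
qed

end
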